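(* Let $T$ be a rooted tree with $n>2$ vertices and let $\lambda_1\ge\lambda_2\ge\cdots\ge\lambda_n$ be all the eigenvalues of $L(T)$ (with multiplicity). Then $$\sqrt{\frac{H(T)}{n(n-1)}}\le\lambda_1\le\sqrt{\frac{n-1}{n}H(T)},\qquad -\sqrt{\frac{n-1}{n}H(T)}\le\lambda_n\le-\sqrt{\frac{H(T)}{n(n-1)}},$$ and $$-\sqrt{\frac{(j-1)H(T)}{n(n-j+1)}}\le\lambda_j\le\sqrt{\frac{(n-j)H(T)}{j\cdot n}}$$ for all $j\in\{2,\ldots,n-1\}$.
   Context: A rooted tree is a finite tree with a distinguished vertex (the root). The level $l(v)$ of a vertex $v$ is its distance from the root. For a rooted tree $T$ with vertices $v_1,\dots,v_n$, the level matrix $L(T)=(l_{ij})$ is the $n\times n$ real symmetric matrix with $l_{ij}=|l(v_i)-l(v_j)|$. Set $H(T)=\sum_{i=1}^n\sum_{j=1}^n l_{ij}^2=2\sum_{1\le i<j\le n}l_{ij}^2$. *)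

theory Defs
  imports
    "Graph_Theory.Graph_Theory"
    "Jordan_Normal_Form.Char_Poly"
    "HOL-Computational_Algebra.Polynomial"
begin

text \<open>
  Graphs are the finite simple graphs of the graph library, i.e. symmetric digraphs without loops
  and parallel arcs. In such a digraph an edge traversed back and forth already satisfies
  \<^const>\<open>pre_digraph.cycle\<close>, so the library predicate \<^const>\<open>tree\<close> is not the
  undirected notion: acyclicity has to be restricted to cycles of length at least 3.
  Connectedness is qualified because of the topological constant of the same name; it includes
  that there is at least one vertex.
\<close>

definition undirected_tree :: "('a, 'b) pre_digraph \<Rightarrow> bool" where
  "undirected_tree T \<longleftrightarrow>
     graph T \<and> Digraph_Component.connected T \<and> (\<nexists>p. pre_digraph.cycle T p \<and> length p \<ge> 3)"

definition rooted_tree :: "('a, 'b) pre_digraph \<Rightarrow> 'a \<Rightarrow> bool" where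
  "rooted_tree T r \<longleftrightarrow> undirected_tree T \<and> r \<in> verts T"

definition level :: "('a, 'b) pre_digraph \<Rightarrow> 'a \<Rightarrow> 'a \<Rightarrow> nat" where
  "level T r v = (LEAST k. \<exists>p. pre_digraph.awalk T r p v \<and> length p = k)"

text \<open>The list \<open>vs\<close> is an enumeration of the vertices.\<close>

definition level_matrix :: "('a, 'b) pre_digraph \<Rightarrow> 'a \<Rightarrow> 'a list \<Rightarrow> real mat" where
  "level_matrix T r vs = mat (length vs) (length vs)
     (\<lambda>(i, j). \<bar>real (level T r (vs ! i)) - real (level T r (vs ! j))\<bar>)"

definition level_H :: "('a, 'b) pre_digraph \<Rightarrow> 'a \<Rightarrow> 'a list \<Rightarrow> real" where
  "level_H T r vs =
     (\<Sum>i<length vs. \<Sum>j<length vs. (level_matrix T r vs $$ (i, j))\<^sup>2)"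

text \<open>
  The real eigenvalues with algebraic multiplicity, in non-increasing order; the \<open>j\<close>-th
  largest one is counted from \<open>j = 1\<close>. For a real symmetric matrix all eigenvalues are
  real (see \<open>length_eigenvalues_desc\<close> below), so that the list has \<open>n\<close> entries.
\<close>

definition eigenvalues_desc :: "real mat \<Rightarrow> real list" where
  "eigenvalues_desc A = rev (sorted_list_of_multiset (proots (char_poly A)))"

definition nth_eigenvalue :: "real mat \<Rightarrow> nat \<Rightarrow> real" where
  "nth_eigenvalue A j = eigenvalues_desc A ! (j - 1)"

lemma level_eq_shortest_path:
  assumes "rooted_tree T r" and "v \<in> verts T"
  shows "wf_digraph.\<mu> T (\<lambda>_. 1) r v = ereal (real (level T r v))"
proof -
  have g: "graph T" and c: "Digraph_Component.connected T" and r: "r \<in> verts T"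
    using assms by (auto simp: rooted_tree_def undirected_tree_def)
  interpret graph T by (rule g)
  have cost: "awalk_cost (\<lambda>_. 1) p = real (length p)" for p :: "'b list"
    by (induction p) auto
  have "strongly_connected T"
    using c by (rule symmetric_connected_imp_strongly_connected[OF sym_arcs])
  hence "r \<rightarrow>\<^sup>*\<^bsub>T\<^esub> v" using r assms(2) by (auto simp: strongly_connected_def)
  then obtain p where p: "apath r p v" "\<mu> (\<lambda>_. 1) r v = awalk_cost (\<lambda>_. 1) p"
    using min_cost_awalk[of r v "\<lambda>_. 1"] by auto
  have "length p \<le> length q" if "awalk r q v" for q
  proof -
    have "ereal (real (length p)) \<le> ereal (real (length q))"
      using min_cost_le_walk_cost[OF that, of "\<lambda>_. 1"] p(2) unfolding cost by simp
    thus ?thesis by simp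
  qed
  hence "level T r v = length p"
    unfolding level_def using p(1) by (intro Least_equality) (auto simp: apath_def)
  thus ?thesis using p(2) cost by simp
qed

lemma real_symmetric_eigenvalue_real:
  assumes A: "A \<in> carrier_mat n n" and sym: "transpose_mat A = (A :: real mat)"
    and ev: "eigenvalue (map_mat complex_of_real A) k"
  shows "k \<in> \<real>"
proof -
  define B where "B = map_mat complex_of_real A"
  have B: "B \<in> carrier_mat n n" using A by (simp add: B_def)
  have symB: "transpose_mat B = B" unfolding B_def using sym by (metis map_mat_transpose)
  from ev obtain v where v: "v \<in> carrier_vec n" "v \<noteq> 0\<^sub>v n" and Bv: "B *\<^sub>v v = k \<cdot>\<^sub>v v"
    using A by (auto simp: eigenvalue_def eigenvector_def B_def)
  have cv: "conjugate v \<in> carrier_vec n" using v by simp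
  have conj: "B *\<^sub>v conjugate v = conjugate (B *\<^sub>v v)"
    using A v by (auto simp: B_def scalar_prod_def sum_conjugate conjugate_complex_def)
  have "k * (v \<bullet> conjugate v) = (B *\<^sub>v v) \<bullet> conjugate v"
    using v cv by (simp add: Bv)
  also have "\<dots> = v \<bullet> (B *\<^sub>v conjugate v)"
    using transpose_vec_mult_scalar[OF B cv v(1)] symB v cv B
    by (metis comm_scalar_prod mult_mat_vec_carrier)
  also have "\<dots> = cnj k * (v \<bullet> conjugate v)"
    using v cv by (simp add: conj Bv conjugate_smult_vec conjugate_complex_def)
  finally have "k = cnj k" using v by simp
  thus ?thesis by (metis Reals_cnj_iff)
qed

lemma length_eigenvalues_desc:
  assumes A: "A \<in> carrier_mat n n" and sym: "transpose_mat A = A"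
  shows "length (eigenvalues_desc A) = n"
proof -
  interpret h: map_poly_inj_comm_ring_hom "complex_of_real" ..
  define B where "B = map_mat complex_of_real A"
  have B: "B \<in> carrier_mat n n" using A by (simp add: B_def)
  obtain as where as: "char_poly B = (\<Prod>a\<leftarrow>as. [:- a, 1:])" "length as = n"
    using char_poly_factorized[OF B] by blast
  have real: "a \<in> \<real>" if "a \<in> set as" for a
  proof -
    have "poly (char_poly B) a = 0"
      using that unfolding as by (auto simp: poly_prod_list prod_list_zero_iff)
    thus ?thesis
      using real_symmetric_eigenvalue_real[OF A sym] eigenvalue_root_char_poly[OF B]
      by (simp add: B_def)
  qed
  define bs where "bs = map Re as"
  have as_bs: "as = map complex_of_real bs"
    using real unfolding bs_def by (simp add: map_idI)
  have "map_poly complex_of_real (char_poly A) = char_poly B"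
    unfolding B_def by (rule of_real_hom.char_poly_hom[OF A, symmetric])
  also have "\<dots> = map_poly complex_of_real (\<Prod>b\<leftarrow>bs. [:- b, 1:])"
    unfolding as as_bs by (simp add: h.hom_prod_list o_def)
  finally have "char_poly A = (\<Prod>b\<leftarrow>bs. [:- b, 1:])" by simp
  moreover have "size (proots (\<Prod>b\<leftarrow>bs. [:- b, 1:])) = length bs"
  proof (induction bs)
    case (Cons b bs)
    have "(\<Prod>b\<leftarrow>bs. [:- b, 1:]) \<noteq> 0" by (auto simp: prod_list_zero_iff)
    with Cons show ?case by (simp add: proots_mult del: mult_pCons_left)
  qed simp
  ultimately have "size (proots (char_poly A)) = n" using as(2) by (simp add: bs_def)
  thus ?thesis
    unfolding eigenvalues_desc_def by (metis length_rev mset_sorted_list_of_multiset size_mset)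
qed

end

theory Submission
  imports
    Defs
    "Jordan_Normal_Form.Schur_Decomposition"
    "HOL-Analysis.Convex"
begin

text \<open>
  The bounds hold for the eigenvalues of every real symmetric matrix with zero diagonal; the level
  matrix of a tree is one of them. Triangularising the matrix puts its eigenvalues on the diagonal
  of a similar matrix, and the trace is invariant under similarity. The eigenvalues therefore sum
  to the trace, which is \<open>0\<close>, and their squares sum to the trace of the squared matrix, which for a
  symmetric matrix is the sum \<open>H\<close> of the squares of all entries
  (\<open>sum_list_eigenvalues_desc\<close>, \<open>sum_list_square_eigenvalues_desc\<close>).

  Everything else concerns \<open>n\<close> real numbers with sum \<open>0\<close> and sum of squares \<open>H\<close>.
  If \<open>a\<close> of them are at least \<open>t > 0\<close>, their sum \<open>S\<close> is at least \<open>a t\<close> and the remaining ones sum to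
  \<open>- S\<close>, so that applying Cauchy-Schwarz to both groups limits \<open>t\<close> in terms of \<open>H\<close>
  (\<open>zero_sum_group_bound\<close>). Taking the \<open>j\<close> largest eigenvalues, or the negatives of
  the \<open>n - j + 1\<close> smallest, yields the upper and the lower bound on the \<open>j\<close>-th one for
  all \<open>j\<close>. Conversely, numbers with sum \<open>0\<close> and maximum \<open>M\<close> are all at least \<open>- (n - 1) M\<close>, and
  confinement to this interval limits \<open>H\<close> in terms of \<open>M\<close> (\<open>zero_sum_max_bound\<close>); this
  keeps the extreme eigenvalues away from \<open>0\<close>.
\<close>

section \<open>Traces and eigenvalues\<close>

definition mat_trace :: "'a :: comm_monoid_add mat \<Rightarrow> 'a" where
  "mat_trace A = (\<Sum>i<dim_row A. A $$ (i, i))"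

lemma mat_trace_mult_comm:
  fixes A B :: "'a :: comm_semiring_0 mat"
  assumes "A \<in> carrier_mat n m" and "B \<in> carrier_mat m n"
  shows "mat_trace (A * B) = mat_trace (B * A)"
proof -
  have "mat_trace (A * B) = (\<Sum>i<n. \<Sum>k<m. A $$ (i, k) * B $$ (k, i))"
    using assms by (simp add: mat_trace_def scalar_prod_def lessThan_atLeast0)
  also have "\<dots> = (\<Sum>k<m. \<Sum>i<n. B $$ (k, i) * A $$ (i, k))"
    by (subst sum.swap) (simp add: mult.commute)
  also have "\<dots> = mat_trace (B * A)"
    using assms by (simp add: mat_trace_def scalar_prod_def lessThan_atLeast0)
  finally show ?thesis .
qed

lemma mat_trace_similar:
  fixes A B :: "'a :: comm_ring_1 mat"
  assumes "similar_mat A B"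
  shows "mat_trace A = mat_trace B"
proof -
  obtain n P Q where carr: "{A, B, P, Q} \<subseteq> carrier_mat n n"
    and QP: "Q * P = 1\<^sub>m n" and A: "A = P * B * Q"
    using similar_matD[OF assms] by blast
  have "mat_trace A = mat_trace (P * (B * Q))"
    using carr A by (auto simp: assoc_mult_mat[of P n n B n Q n])
  also have "\<dots> = mat_trace (B * Q * P)"
    using carr by (intro mat_trace_mult_comm) auto
  also have "B * Q * P = B"
    using carr QP by (auto simp: assoc_mult_mat[of B n n Q n P n])
  finally show ?thesis .
qed

text \<open>Below the diagonal one factor of each product vanishes, above it the other one.\<close>

lemma diag_square_upper_triangular:
  fixes B :: "'a :: semiring_1 mat"
  assumes "B \<in> carrier_mat n n" and "upper_triangular B" and "i < n"
  shows "(B * B) $$ (i, i) = (B $$ (i, i))\<^sup>2"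
proof -
  have "(B * B) $$ (i, i) = (\<Sum>k<n. B $$ (i, k) * B $$ (k, i))"
    using assms by (simp add: scalar_prod_def lessThan_atLeast0)
  also have "\<dots> = (\<Sum>k\<in>{i}. B $$ (i, k) * B $$ (k, i))"
  proof (rule sum.mono_neutral_right)
    show "\<forall>k\<in>{..<n} - {i}. B $$ (i, k) * B $$ (k, i) = 0"
    proof
      fix k assume k: "k \<in> {..<n} - {i}"
      then consider "k < i" | "i < k" by fastforce
      then show "B $$ (i, k) * B $$ (k, i) = 0"
        using assms k by cases (auto simp: upper_triangularD)
    qed
  qed (use assms in auto)
  finally show ?thesis by (simp add: power2_eq_square)
qed

text \<open>
  Schur decomposition yields an upper triangular matrix similar to \<open>A\<close> with diagonal \<open>es\<close>. Its square
  is similar to \<open>A * A\<close> and has the squares of \<open>es\<close> on the diagonal.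
\<close>

lemma sum_list_eq_mat_trace:
  fixes A :: "'a :: conjugatable_ordered_field mat"
  assumes A: "A \<in> carrier_mat n n" and split: "char_poly A = (\<Prod>e\<leftarrow>es. [:- e, 1:])"
  shows "sum_list es = mat_trace A"
    and "(\<Sum>e\<leftarrow>es. e\<^sup>2) = mat_trace (A * A)"
proof -
  obtain B P Q where "schur_decomposition A es = (B, P, Q)"
    by (cases "schur_decomposition A es") auto
  from schur_decomposition[OF A split this]
  have sim: "similar_mat_wit A B P Q" and tri: "upper_triangular B" and diag: "diag_mat B = es"
    by auto
  have B: "B \<in> carrier_mat n n"
    using sim A by (auto simp: similar_mat_wit_def Let_def)
  have es: "es = map (\<lambda>i. B $$ (i, i)) [0..<n]"
    using diag B by (auto simp: diag_mat_def)
  have "mat_trace A = mat_trace B"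
    using sim by (intro mat_trace_similar) (auto simp: similar_mat_def)
  then show "sum_list es = mat_trace A"
    using B by (simp add: es mat_trace_def interv_sum_list_conv_sum_set_nat lessThan_atLeast0)
  have "similar_mat (A ^\<^sub>m 2) (B ^\<^sub>m 2)"
    using similar_mat_wit_pow[OF sim] by (auto simp: similar_mat_def)
  then have "mat_trace (A ^\<^sub>m 2) = mat_trace (B ^\<^sub>m 2)"
    by (rule mat_trace_similar)
  then have "mat_trace (A * A) = mat_trace (B * B)"
    using A B by (simp add: numeral_2_eq_2)
  also have "\<dots> = (\<Sum>i<n. (B $$ (i, i))\<^sup>2)"
    using B diag_square_upper_triangular[OF B tri] by (auto simp: mat_trace_def)
  finally show "(\<Sum>e\<leftarrow>es. e\<^sup>2) = mat_trace (A * A)"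
    by (simp add: es o_def interv_sum_list_conv_sum_set_nat lessThan_atLeast0)
qed

text \<open>Splitting off a root lowers both the degree and the number of roots by one.\<close>

lemma monic_eq_prod_mset_proots:
  fixes p :: "'a :: field poly"
  assumes "size (proots p) = degree p" and "lead_coeff p = 1"
  shows "p = (\<Prod>a\<in>#proots p. [:- a, 1:])"
  using assms
proof (induction "degree p" arbitrary: p)
  case 0
  then have "p = 1" by (metis monic_degree_0)
  then show ?case by simp
next
  case (Suc d)
  have p0: "p \<noteq> 0" using Suc.prems(2) by auto
  obtain a where "a \<in># proots p"
    using Suc.hyps(2) Suc.prems(1) by (metis multiset_nonemptyE size_empty Zero_not_Suc)
  then obtain q where p: "p = [:- a, 1:] * q"
    using p0 by (auto simp: poly_eq_0_iff_dvd elim: dvdE)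
  have q0: "q \<noteq> 0" using p0 p by auto
  have roots: "proots p = {#a#} + proots q"
    using q0 unfolding p by (subst proots_mult) auto
  have deg: "degree p = Suc (degree q)"
    using q0 unfolding p by (subst degree_mult_eq) auto
  have "lead_coeff q = 1"
    using Suc.prems(2) unfolding p lead_coeff_mult by simp
  moreover have "d = degree q" and "size (proots q) = degree q"
    using Suc.hyps(2) Suc.prems(1) deg roots by simp_all
  ultimately have q: "q = (\<Prod>a\<in>#proots q. [:- a, 1:])"
    using Suc.hyps(1) by blast
  have "(\<Prod>a\<in>#proots p. [:- a, 1:]) = [:- a, 1:] * (\<Prod>a\<in>#proots q. [:- a, 1:])"
    unfolding roots by (simp del: mult_pCons_left)
  then show ?case using p q by metis
qed

lemma char_poly_eq_prod_eigenvalues_desc: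
  assumes A: "A \<in> carrier_mat n n" and sym: "transpose_mat A = A"
  shows "char_poly A = (\<Prod>e\<leftarrow>eigenvalues_desc A. [:- e, 1:])"
proof -
  have mset: "mset (eigenvalues_desc A) = proots (char_poly A)"
    by (simp add: eigenvalues_desc_def)
  then have "size (proots (char_poly A)) = n"
    using length_eigenvalues_desc[OF A sym] by (metis size_mset)
  then have "char_poly A = (\<Prod>e\<in>#mset (eigenvalues_desc A). [:- e, 1:])"
    unfolding mset using degree_monic_char_poly[OF A] by (intro monic_eq_prod_mset_proots) auto
  then show ?thesis by (metis mset_map prod_mset_prod_list)
qed

lemma sum_list_eigenvalues_desc:
  assumes "A \<in> carrier_mat n n" and "transpose_mat A = A"
  shows "sum_list (eigenvalues_desc A) = mat_trace A"
  using assms by (intro sum_list_eq_mat_trace char_poly_eq_prod_eigenvalues_desc)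

lemma sum_list_square_eigenvalues_desc:
  assumes A: "A \<in> carrier_mat n n" and sym: "transpose_mat A = A"
  shows "(\<Sum>e\<leftarrow>eigenvalues_desc A. e\<^sup>2) = (\<Sum>i<n. \<Sum>j<n. (A $$ (i, j))\<^sup>2)"
proof -
  have entry: "A $$ (j, i) = A $$ (i, j)" if "i < n" "j < n" for i j
    using that A sym by (metis carrier_matD index_transpose_mat(1))
  have "(\<Sum>e\<leftarrow>eigenvalues_desc A. e\<^sup>2) = mat_trace (A * A)"
    using assms by (intro sum_list_eq_mat_trace char_poly_eq_prod_eigenvalues_desc)
  also have "\<dots> = (\<Sum>i<n. \<Sum>j<n. A $$ (i, j) * A $$ (j, i))"
    using A by (simp add: mat_trace_def scalar_prod_def lessThan_atLeast0)
  also have "\<dots> = (\<Sum>i<n. \<Sum>j<n. (A $$ (i, j))\<^sup>2)"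
    by (intro sum.cong refl) (simp add: entry power2_eq_square)
  finally show ?thesis .
qed

lemma eigenvalues_desc_antimono:
  assumes "i \<le> j" and "j < length (eigenvalues_desc A)"
  shows "eigenvalues_desc A ! j \<le> eigenvalues_desc A ! i"
  using assms unfolding eigenvalues_desc_def by (intro sorted_rev_nth_mono) simp_all

section \<open>Real numbers with zero sum and given sum of squares\<close>

text \<open>
  The group \<open>A\<close> has sum at least \<open>t\<close> times its size, and its complement has the opposite sum.
  Cauchy-Schwarz on each of the two groups bounds the common square of the two sums.
\<close>

lemma zero_sum_group_bound:
  fixes f :: "'i \<Rightarrow> real"
  assumes I: "finite I" and A: "A \<subseteq> I" "A \<noteq> {}"
    and zero: "(\<Sum>i\<in>I. f i) = 0" and ge: "\<And>i. i \<in> A \<Longrightarrow> t \<le> f i"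
  shows "t \<le> sqrt ((real (card I) - real (card A)) * (\<Sum>i\<in>I. (f i)\<^sup>2)
    / (real (card A) * real (card I)))"
proof (cases "t \<le> 0")
  case True
  have "card A \<le> card I" using I A by (intro card_mono)
  then have "0 \<le> (real (card I) - real (card A)) * (\<Sum>i\<in>I. (f i)\<^sup>2) / (real (card A) * real (card I))"
    by (intro divide_nonneg_nonneg mult_nonneg_nonneg sum_nonneg) auto
  then show ?thesis using True by (meson order_trans real_sqrt_ge_zero)
next
  case False
  define a b where "a = real (card A)" and "b = real (card (I - A))"
  define S QA QB where "S = (\<Sum>i\<in>A. f i)" and "QA = (\<Sum>i\<in>A. (f i)\<^sup>2)"
    and "QB = (\<Sum>i\<in>I - A. (f i)\<^sup>2)"
  have fin: "finite A" using I A finite_subset by blast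
  have cardI: "real (card I) = a + b"
    using I A card_mono[OF I A(1)] by (simp add: a_def b_def card_Diff_subset[OF fin A(1)])
  have a: "a > 0" using fin A by (simp add: a_def card_gt_0_iff)
  have b: "b \<ge> 0" by (simp add: b_def)
  have Q: "(\<Sum>i\<in>I. (f i)\<^sup>2) = QA + QB"
    using sum.subset_diff[OF A(1) I, of "\<lambda>i. (f i)\<^sup>2"] by (simp add: QA_def QB_def)
  have compl: "(\<Sum>i\<in>I - A. f i) = - S"
    using zero sum.subset_diff[OF A(1) I, of f] by (simp add: S_def)
  have CA: "S\<^sup>2 \<le> QA * a"
    unfolding S_def QA_def a_def by (rule sum_squared_le_sum_of_squares)
  have CB: "S\<^sup>2 \<le> QB * b"
    using sum_squared_le_sum_of_squares[of f "I - A"] unfolding compl QB_def b_def by simp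
  have "a * t \<le> S"
    unfolding a_def S_def using sum_bounded_below[of A t f] ge by simp
  then have "(a * t)\<^sup>2 \<le> S\<^sup>2"
    using False a by (intro power_mono) auto
  then have "(a + b) * (a * t)\<^sup>2 \<le> a * S\<^sup>2 + b * S\<^sup>2"
    using a b by (simp add: distrib_right[symmetric] mult_left_mono)
  also have "\<dots> \<le> a * (QB * b) + b * (QA * a)"
    using CA CB a b by (intro add_mono mult_left_mono) auto
  finally have "a * ((a + b) * a * t\<^sup>2) \<le> a * (b * (QA + QB))"
    by (simp add: algebra_simps power2_eq_square)
  then have "(a + b) * a * t\<^sup>2 \<le> b * (QA + QB)"
    using a by (simp only: mult_le_cancel_left_pos)
  then have "t\<^sup>2 \<le> b * (QA + QB) / (a * (a + b))"
    using a b by (simp add: pos_le_divide_eq mult_ac)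
  then have "t \<le> sqrt (b * (QA + QB) / (a * (a + b)))"
    by (rule real_le_rsqrt)
  then show ?thesis unfolding cardI Q a_def[symmetric] by simp
qed

text \<open>
  A number is minus the sum of the other \<open>card I - 1\<close> ones, hence at least
  \<open>- (card I - 1) * M\<close>. So \<open>(M - f i) * (f i + (card I - 1) * M)\<close> is nonnegative, and its terms
  linear in \<open>f i\<close> disappear on summation.
\<close>

lemma zero_sum_max_bound:
  fixes f :: "'i \<Rightarrow> real"
  assumes I: "finite I" "I \<noteq> {}"
    and zero: "(\<Sum>i\<in>I. f i) = 0" and le: "\<And>i. i \<in> I \<Longrightarrow> f i \<le> M"
  shows "sqrt ((\<Sum>i\<in>I. (f i)\<^sup>2) / (real (card I) * (real (card I) - 1))) \<le> M"
proof -
  define n where "n = real (card I)"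
  have card: "card I > 0" using I by (simp add: card_gt_0_iff)
  then have n: "n \<ge> 1" by (simp add: n_def)
  have "0 \<le> n * M"
    using sum_bounded_above[of I f M] le zero by (simp add: n_def)
  then have M: "0 \<le> M" using n by (simp add: zero_le_mult_iff)
  have low: "0 \<le> f i + (n - 1) * M" if i: "i \<in> I" for i
  proof -
    have "(\<Sum>k\<in>I - {i}. f k) \<le> real (card (I - {i})) * M"
      using sum_bounded_above[of "I - {i}" f M] le by simp
    moreover have "real (card (I - {i})) = n - 1"
      using I i card by (simp add: n_def of_nat_diff)
    ultimately show ?thesis using sum.remove[OF I(1) i, of f] zero by simp
  qed
  have "0 \<le> (\<Sum>i\<in>I. (M - f i) * (f i + (n - 1) * M))"
    using le low by (intro sum_nonneg mult_nonneg_nonneg) auto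
  also have "\<dots> = (\<Sum>i\<in>I. (n - 1) * M\<^sup>2 - (n - 2) * M * f i - (f i)\<^sup>2)"
    by (intro sum.cong refl) (simp add: algebra_simps power2_eq_square)
  also have "\<dots> = n * (n - 1) * M\<^sup>2 - (\<Sum>i\<in>I. (f i)\<^sup>2)"
    by (simp add: sum_subtractf sum_distrib_left[symmetric] zero n_def)
  finally have H: "(\<Sum>i\<in>I. (f i)\<^sup>2) \<le> M\<^sup>2 * (n * (n - 1))" by (simp add: mult_ac)
  have "(\<Sum>i\<in>I. (f i)\<^sup>2) / (n * (n - 1)) \<le> M\<^sup>2"
  proof (cases "n = 1")
    \<comment> \<open>Here the denominator vanishes, and the quotient is \<open>0\<close> by convention.\<close>
    case True
    then show ?thesis by simp
  next
    case False
    then have "n * (n - 1) > 0" using n by simp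
    with H show ?thesis by (simp add: divide_le_eq)
  qed
  then show ?thesis using M unfolding n_def by (intro real_le_lsqrt)
qed

section \<open>The eigenvalue bounds\<close>

context
  fixes A :: "real mat" and n :: nat and H :: real
  assumes A: "A \<in> carrier_mat n n" and sym: "transpose_mat A = A"
    and diag0: "\<And>i. i < n \<Longrightarrow> A $$ (i, i) = 0"
  defines "H \<equiv> \<Sum>i<n. \<Sum>j<n. (A $$ (i, j))\<^sup>2"
begin

private abbreviation "ev \<equiv> (!) (eigenvalues_desc A)"

private lemma sum_ev: "(\<Sum>i<n. ev i) = 0" and sum_square_ev: "(\<Sum>i<n. (ev i)\<^sup>2) = H"
proof -
  note len = length_eigenvalues_desc[OF A sym]
  have "(\<Sum>i<n. ev i) = mat_trace A"
    using sum_list_eigenvalues_desc[OF A sym] by (simp add: sum_list_sum_nth len lessThan_atLeast0)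
  then show "(\<Sum>i<n. ev i) = 0"
    using A diag0 by (simp add: mat_trace_def)
  show "(\<Sum>i<n. (ev i)\<^sup>2) = H"
    using sum_list_square_eigenvalues_desc[OF A sym]
    by (simp add: sum_list_sum_nth len lessThan_atLeast0 H_def)
qed

private lemma ev_antimono: "i \<le> j \<Longrightarrow> j < n \<Longrightarrow> ev j \<le> ev i"
  using eigenvalues_desc_antimono length_eigenvalues_desc[OF A sym] by simp

lemma nth_eigenvalue_le:
  assumes "1 \<le> j" and "j \<le> n"
  shows "nth_eigenvalue A j \<le> sqrt ((real n - real j) * H / (real j * real n))"
proof -
  have "ev (j - 1) \<le> ev i" if "i \<in> {..<j}" for i
    using that assms by (intro ev_antimono) auto
  then have "ev (j - 1) \<le> sqrt ((real (card {..<n}) - real (card {..<j})) * (\<Sum>i<n. (ev i)\<^sup>2)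
      / (real (card {..<j}) * real (card {..<n})))"
    using assms sum_ev by (intro zero_sum_group_bound) (auto simp: lessThan_empty_iff)
  then show ?thesis by (simp add: nth_eigenvalue_def sum_square_ev)
qed

lemma nth_eigenvalue_ge:
  assumes "1 \<le> j" and "j \<le> n"
  shows "- sqrt ((real j - 1) * H / (real n * (real n - real j + 1))) \<le> nth_eigenvalue A j"
proof -
  have "- ev (j - 1) \<le> - ev i" if "i \<in> {j - 1..<n}" for i
    using that by (auto intro: ev_antimono)
  then have "- ev (j - 1)
      \<le> sqrt ((real (card {..<n}) - real (card {j - 1..<n})) * (\<Sum>i<n. (- ev i)\<^sup>2)
          / (real (card {j - 1..<n}) * real (card {..<n})))"
    using assms sum_ev by (intro zero_sum_group_bound) (auto simp: sum_negf)
  also have "real (card {j - 1..<n}) = real n - real j + 1"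
    using assms by (simp add: of_nat_diff)
  finally show ?thesis
    by (simp add: nth_eigenvalue_def sum_square_ev mult.commute)
qed

lemma largest_eigenvalue_ge:
  assumes "n > 0"
  shows "sqrt (H / (real n * (real n - 1))) \<le> nth_eigenvalue A 1"
proof -
  have "ev i \<le> ev 0" if "i \<in> {..<n}" for i
    using that by (auto intro: ev_antimono)
  then have "sqrt ((\<Sum>i<n. (ev i)\<^sup>2) / (real (card {..<n}) * (real (card {..<n}) - 1))) \<le> ev 0"
    using assms sum_ev by (intro zero_sum_max_bound) (auto simp: lessThan_empty_iff)
  then show ?thesis by (simp add: nth_eigenvalue_def sum_square_ev)
qed

lemma smallest_eigenvalue_le:
  assumes "n > 0"
  shows "nth_eigenvalue A n \<le> - sqrt (H / (real n * (real n - 1)))"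
proof -
  have "- ev i \<le> - ev (n - 1)" if "i \<in> {..<n}" for i
    using that by (auto intro: ev_antimono)
  then have "sqrt ((\<Sum>i<n. (- ev i)\<^sup>2) / (real (card {..<n}) * (real (card {..<n}) - 1)))
      \<le> - ev (n - 1)"
    using assms sum_ev by (intro zero_sum_max_bound) (auto simp: sum_negf lessThan_empty_iff)
  then show ?thesis by (simp add: nth_eigenvalue_def sum_square_ev)
qed

end

theorem theorem9:
  fixes T :: "('a, 'b) pre_digraph" and r :: 'a and vs :: "'a list" and n :: nat
    and H :: real and lam :: "nat \<Rightarrow> real"
  assumes "rooted_tree T r"
    and "distinct vs" and "set vs = verts T"
    and "n = card (verts T)" and "n > 2"
    and "H = level_H T r vs"
    and "lam = nth_eigenvalue (level_matrix T r vs)"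
  shows "sqrt (H / (real n * (real n - 1))) \<le> lam 1 \<and>
      lam 1 \<le> sqrt ((real n - 1) / real n * H) \<and>
      - sqrt ((real n - 1) / real n * H) \<le> lam n \<and>
      lam n \<le> - sqrt (H / (real n * (real n - 1))) \<and>
      (\<forall>j\<in>{2..n - 1}.
        - sqrt ((real j - 1) * H / (real n * (real n - real j + 1))) \<le> lam j \<and>
        lam j \<le> sqrt ((real n - real j) * H / (real j * real n)))"
proof -
  define A where "A = level_matrix T r vs"
  have len: "length vs = n"
    using assms(2-4) by (metis distinct_card)
  have A: "A \<in> carrier_mat n n"
    by (simp add: A_def level_matrix_def len)
  have diag0: "A $$ (i, i) = 0" if "i < n" for i
    using that by (simp add: A_def level_matrix_def len)
  have sym: "transpose_mat A = A"
    by (rule eq_matI) (auto simp: A_def level_matrix_def len abs_minus_commute)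
  have H: "H = (\<Sum>i<n. \<Sum>j<n. (A $$ (i, j))\<^sup>2)"
    using assms(6) by (simp add: level_H_def len A_def)
  have lam: "lam = nth_eigenvalue A" using assms(7) by (simp add: A_def)
  have le: "lam j \<le> sqrt ((real n - real j) * H / (real j * real n))"
    and ge: "- sqrt ((real j - 1) * H / (real n * (real n - real j + 1))) \<le> lam j"
    if "1 \<le> j" "j \<le> n" for j
    unfolding H lam using that
    by (auto intro: nth_eigenvalue_le[OF A sym diag0] nth_eigenvalue_ge[OF A sym diag0])
  have "sqrt (H / (real n * (real n - 1))) \<le> lam 1"
    unfolding H lam using assms(5) by (intro largest_eigenvalue_ge[OF A sym diag0]) auto
  moreover have "lam n \<le> - sqrt (H / (real n * (real n - 1)))"
    unfolding H lam using assms(5) by (intro smallest_eigenvalue_le[OF A sym diag0]) auto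
  moreover have "lam 1 \<le> sqrt ((real n - 1) / real n * H)"
    using le[of 1] assms(5) by simp
  moreover have "- sqrt ((real n - 1) / real n * H) \<le> lam n"
    using ge[of n] assms(5) by simp
  moreover have "\<forall>j\<in>{2..n - 1}.
      - sqrt ((real j - 1) * H / (real n * (real n - real j + 1))) \<le> lam j \<and>
      lam j \<le> sqrt ((real n - real j) * H / (real j * real n))"
    using le ge by auto
  ultimately show ?thesis by blast
qed

end
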